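(* Let $\varphi:\mathcal{W}_1(\mathbb{R})\to\mathcal{W}_1(\mathbb{R})$ be an isometry, that is, a bijection satisfying $d_{\mathcal{W}_1}(\varphi(\mu),\varphi(\nu))=d_{\mathcal{W}_1}(\mu,\nu)$ for all $\mu,\nu\in\mathcal{W}_1(\mathbb{R})$. Then $\varphi=\psi_\#$ for some isometry $\psi\in\mathrm{Isom}(\mathbb{R})$. Therefore $\mathrm{Isom}(\mathcal{W}_1(\mathbb{R}))=\mathrm{Isom}(\mathbb{R})$, where $\mathrm{Isom}(\mathbb{R})$ is identified with a subgroup of $\mathrm{Isom}(\mathcal{W}_1(\mathbb{R}))$ via the injective group homomorphism $\psi\mapsto\psi_\#$.
   Context: $\mathcal{W}_1(\mathbb{R})$ is the set of Borel probability measures $\mu$ on $\mathbb{R}$ with $\int|x|\,d\mu(x)<\infty$, with the $1$-Wasserstein distance $d_{\mathcal{W}_1}(\mu,\nu)=\inf_{\pi}\int |x-y|\,d\pi(x,y)$, the infimum being over all couplings $\pi$ of $\mu$ and $\nu$. $\mathbb{R}$ carries the metric $|x-y|$. $\mathrm{Isom}$ denotes the group of surjective distance preserving self-maps of a metric space. The push-forward $\psi_\#$ is $(\psi_\#\mu)(A)=\mu(\psi^{-1}[A])$ for Borel $A\subseteq\mathbb{R}$. *)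

theory Defs
  imports "HOL-Probability.Probability" "HOL-Algebra.Bij"
begin

definition W1_space :: "real measure set" where
  "W1_space = {\<mu>. prob_space \<mu> \<and> sets \<mu> = sets borel \<and> (\<integral>\<^sup>+ x. ennreal \<bar>x\<bar> \<partial>\<mu>) < \<infinity>}"

definition couplings :: "real measure \<Rightarrow> real measure \<Rightarrow> (real \<times> real) measure set" where
  "couplings \<mu> \<nu> = {\<pi>. prob_space \<pi> \<and> sets \<pi> = sets (borel \<Otimes>\<^sub>M borel)
     \<and> distr \<pi> borel fst = \<mu> \<and> distr \<pi> borel snd = \<nu>}"

definition W1_cost :: "real measure \<Rightarrow> real measure \<Rightarrow> ennreal" where
  "W1_cost \<mu> \<nu> = (\<Sqinter>\<pi>\<in>couplings \<mu> \<nu>. \<integral>\<^sup>+ (x, y). ennreal \<bar>x - y\<bar> \<partial>\<pi>)"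

text \<open>The infimum is taken in the extended non-negative reals, and it is finite on
  \<^const>\<open>W1_space\<close> (lemma \<open>W1_cost_finite\<close> below), so \<^const>\<open>enn2real\<close> loses nothing there.\<close>

definition W1_dist :: "real measure \<Rightarrow> real measure \<Rightarrow> real" where
  "W1_dist \<mu> \<nu> = enn2real (W1_cost \<mu> \<nu>)"

text \<open>As in \<^const>\<open>Bij\<close>, self-maps of a carrier set are taken extensional, so that two of them
  are equal as soon as they agree on the carrier.\<close>

definition Isom :: "'a set \<Rightarrow> ('a \<Rightarrow> 'a \<Rightarrow> real) \<Rightarrow> ('a \<Rightarrow> 'a) set" where
  "Isom M d = {f \<in> extensional M. f ` M = M \<and> (\<forall>x\<in>M. \<forall>y\<in>M. d (f x) (f y) = d x y)}"

definition IsomGroup :: "'a set \<Rightarrow> ('a \<Rightarrow> 'a \<Rightarrow> real) \<Rightarrow> ('a \<Rightarrow> 'a) monoid" where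
  "IsomGroup M d = \<lparr>carrier = Isom M d, mult = compose M, one = (\<lambda>x\<in>M. x)\<rparr>"

definition W1_push :: "(real \<Rightarrow> real) \<Rightarrow> real measure \<Rightarrow> real measure" where
  "W1_push \<psi> = (\<lambda>\<mu>\<in>W1_space. distr \<mu> borel \<psi>)"

lemma product_coupling:
  assumes "\<mu> \<in> W1_space" "\<nu> \<in> W1_space"
  shows "\<mu> \<Otimes>\<^sub>M \<nu> \<in> couplings \<mu> \<nu>"
proof -
  interpret M: prob_space \<mu> using assms by (simp add: W1_space_def)
  interpret N: prob_space \<nu> using assms by (simp add: W1_space_def)
  interpret P: pair_prob_space \<mu> \<nu> ..
  have [measurable_cong]: "sets \<mu> = sets borel" "sets \<nu> = sets borel"
    using assms by (auto simp: W1_space_def)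
  then have sp: "space \<mu> = UNIV" "space \<nu> = UNIV"
    by (auto dest: sets_eq_imp_space_eq)
  have "distr (\<mu> \<Otimes>\<^sub>M \<nu>) borel fst = \<mu>"
  proof (rule measure_eqI)
    fix A assume "A \<in> sets (distr (\<mu> \<Otimes>\<^sub>M \<nu>) borel fst)"
    then have [measurable]: "A \<in> sets borel" by simp
    have "fst -` A \<inter> space (\<mu> \<Otimes>\<^sub>M \<nu>) = A \<times> UNIV" by (auto simp: space_pair_measure sp)
    then show "emeasure (distr (\<mu> \<Otimes>\<^sub>M \<nu>) borel fst) A = emeasure \<mu> A"
      using N.emeasure_space_1 sp
      by (simp add: emeasure_distr N.emeasure_pair_measure_Times \<open>sets \<mu> = _\<close> \<open>sets \<nu> = _\<close>)
  qed (simp add: \<open>sets \<mu> = _\<close>)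
  moreover have "distr (\<mu> \<Otimes>\<^sub>M \<nu>) borel snd = \<nu>"
  proof (rule measure_eqI)
    fix A assume "A \<in> sets (distr (\<mu> \<Otimes>\<^sub>M \<nu>) borel snd)"
    then have [measurable]: "A \<in> sets borel" by simp
    have "snd -` A \<inter> space (\<mu> \<Otimes>\<^sub>M \<nu>) = UNIV \<times> A" by (auto simp: space_pair_measure sp)
    then show "emeasure (distr (\<mu> \<Otimes>\<^sub>M \<nu>) borel snd) A = emeasure \<nu> A"
      using M.emeasure_space_1 sp
      by (simp add: emeasure_distr N.emeasure_pair_measure_Times \<open>sets \<mu> = _\<close> \<open>sets \<nu> = _\<close>)
  qed (simp add: \<open>sets \<nu> = _\<close>)
  ultimately show ?thesis
    by (simp add: couplings_def P.prob_space_axioms cong: sets_pair_measure_cong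
        add: \<open>sets \<mu> = _\<close> \<open>sets \<nu> = _\<close>)
qed

lemma W1_cost_finite:
  assumes "\<mu> \<in> W1_space" "\<nu> \<in> W1_space"
  shows "W1_cost \<mu> \<nu> < \<infinity>"
proof -
  define \<pi> where "\<pi> = \<mu> \<Otimes>\<^sub>M \<nu>"
  have \<pi>: "\<pi> \<in> couplings \<mu> \<nu>" unfolding \<pi>_def by (rule product_coupling[OF assms])
  then have [measurable_cong]: "sets \<pi> = sets (borel \<Otimes>\<^sub>M borel)" by (simp add: couplings_def)
  have "W1_cost \<mu> \<nu> \<le> (\<integral>\<^sup>+ (x, y). ennreal \<bar>x - y\<bar> \<partial>\<pi>)"
    unfolding W1_cost_def by (rule INF_lower[OF \<pi>])
  also have "\<dots> \<le> (\<integral>\<^sup>+ p. ennreal \<bar>fst p\<bar> + ennreal \<bar>snd p\<bar> \<partial>\<pi>)"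
    by (intro nn_integral_mono) (auto simp flip: ennreal_plus intro!: ennreal_leI)
  also have "\<dots> = (\<integral>\<^sup>+ p. ennreal \<bar>fst p\<bar> \<partial>\<pi>) + (\<integral>\<^sup>+ p. ennreal \<bar>snd p\<bar> \<partial>\<pi>)"
    by (intro nn_integral_add) measurable
  also have "(\<integral>\<^sup>+ p. ennreal \<bar>fst p\<bar> \<partial>\<pi>) = (\<integral>\<^sup>+ x. ennreal \<bar>x\<bar> \<partial>distr \<pi> borel fst)"
    by (rule nn_integral_distr[symmetric]) measurable
  also have "(\<integral>\<^sup>+ p. ennreal \<bar>snd p\<bar> \<partial>\<pi>) = (\<integral>\<^sup>+ x. ennreal \<bar>x\<bar> \<partial>distr \<pi> borel snd)"
    by (rule nn_integral_distr[symmetric]) measurable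
  finally show ?thesis
    using \<pi> assms by (auto simp: couplings_def W1_space_def less_top[symmetric] top_unique)
qed

end

theory Submission
  imports Defs
begin

text \<open>Say that \<open>\<eta>\<close> lies between \<open>\<mu>\<close> and \<open>\<nu>\<close> if \<open>d \<mu> \<eta> + d \<nu> \<eta> \<le> d \<mu> \<nu>\<close>. A Dirac measure
  at \<open>t\<close> lies between \<open>\<mu>\<close> and \<open>\<nu>\<close> only if these do not both charge the same open half-line
  bounded by \<open>t\<close>; hence, by the pigeonhole principle, it cannot lie pairwise between three measures
  all different from it. Any other measure does lie pairwise between three measures different from
  it: with \<open>c\<close> its mean, move the part on the left of \<open>c\<close> to the left, or move the rest to the
  right, or collapse everything to \<open>c\<close>. So isometries permute the Dirac measures, through an isometry
  \<open>\<psi>\<close> of the line. Finally the distances \<open>d \<mu> \<delta>\<^sub>t = \<integral>\<bar>x - t\<bar> d\<mu>\<close> determine \<open>\<mu>\<close>, because the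
  right derivative in \<open>t\<close> is \<open>2 F t - 1\<close> with \<open>F\<close> the distribution function of \<open>\<mu>\<close>.\<close>

section \<open>Estimates for the Wasserstein distance\<close>

abbreviation dirac :: "real \<Rightarrow> real measure" where
  "dirac t \<equiv> return borel t"

lemma W1_space_iff:
  "\<mu> \<in> W1_space \<longleftrightarrow> prob_space \<mu> \<and> sets \<mu> = sets borel \<and> integrable \<mu> (\<lambda>x. x)"
proof -
  have "(\<lambda>x. x) \<in> borel_measurable \<mu>" if "sets \<mu> = sets borel"
    using measurable_ident_sets[OF that] by simp
  then show ?thesis
    by (auto simp: W1_space_def integrable_iff_bounded)
qed

lemma W1_spaceD:
  assumes "\<mu> \<in> W1_space"
  shows "prob_space \<mu>" "sets \<mu> = sets borel" "integrable \<mu> (\<lambda>x. x)" "space \<mu> = UNIV"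
    "measurable \<mu> N = measurable borel N"
proof -
  show *: "prob_space \<mu>" "sets \<mu> = sets borel" "integrable \<mu> (\<lambda>x. x)"
    using assms by (auto simp: W1_space_iff)
  show "space \<mu> = UNIV" using sets_eq_imp_space_eq[OF *(2)] by simp
  show "measurable \<mu> N = measurable borel N" by (rule measurable_cong_sets[OF *(2) refl])
qed

text \<open>A 1-Lipschitz \<open>f\<close> satisfies the growth bound with
  \<open>C = \<bar>f 0\<bar>\<close>; the bound also admits the discontinuous maps \<open>L\<close>
  and \<open>R\<close> used later.\<close>

lemma integrable_W1_Lipschitz:
  fixes f :: "real \<Rightarrow> real"
  assumes \<mu>: "\<mu> \<in> W1_space" and [measurable]: "f \<in> borel_measurable borel"
    and f: "\<And>x. \<bar>f x\<bar> \<le> \<bar>x\<bar> + C"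
  shows "integrable \<mu> f"
proof -
  interpret prob_space \<mu> by (rule W1_spaceD[OF \<mu>])
  have "integrable \<mu> (\<lambda>x. \<bar>x\<bar> + C)" using W1_spaceD(3)[OF \<mu>] by auto
  then show ?thesis
    by (rule Bochner_Integration.integrable_bound)
      (use order_trans[OF f abs_ge_self] in \<open>auto simp: W1_spaceD(5)[OF \<mu>]\<close>)
qed

lemma dirac_W1: "dirac t \<in> W1_space"
  by (simp add: W1_space_def prob_space_return nn_integral_return)

lemma distr_W1:
  assumes \<mu>: "\<mu> \<in> W1_space" and [measurable]: "f \<in> borel_measurable borel"
    and f: "\<And>x. \<bar>f x\<bar> \<le> \<bar>x\<bar> + C"
  shows "distr \<mu> borel f \<in> W1_space"
proof -
  have [measurable]: "f \<in> borel_measurable \<mu>" by (simp add: W1_spaceD(5)[OF \<mu>])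
  show ?thesis
    using integrable_W1_Lipschitz[OF \<mu> _ f] prob_space.prob_space_distr[OF W1_spaceD(1)[OF \<mu>]]
    by (auto simp: W1_space_iff integrable_distr_eq)
qed

lemma distr_const_dirac: "\<mu> \<in> W1_space \<Longrightarrow> distr \<mu> borel (\<lambda>x. t) = dirac t"
  by (simp add: prob_space.distr_const W1_spaceD)

lemma distr_id_W1: "\<mu> \<in> W1_space \<Longrightarrow> distr \<mu> borel (\<lambda>x. x) = \<mu>"
  by (simp add: distr_id2 W1_spaceD)

lemma couplings_integrable:
  fixes f :: "real \<Rightarrow> real"
  assumes \<pi>: "\<pi> \<in> couplings \<mu> \<nu>"
  shows "integrable \<mu> f \<Longrightarrow> integrable \<pi> (\<lambda>p. f (fst p))"
    "integrable \<nu> f \<Longrightarrow> integrable \<pi> (\<lambda>p. f (snd p))"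
    "integrable \<mu> f \<Longrightarrow> (\<integral>p. f (fst p) \<partial>\<pi>) = (\<integral>x. f x \<partial>\<mu>)"
    "integrable \<nu> f \<Longrightarrow> (\<integral>p. f (snd p) \<partial>\<pi>) = (\<integral>x. f x \<partial>\<nu>)"
proof -
  have [measurable_cong]: "sets \<pi> = sets (borel \<Otimes>\<^sub>M borel)"
    and d: "distr \<pi> borel fst = \<mu>" "distr \<pi> borel snd = \<nu>"
    using \<pi> by (auto simp: couplings_def)
  have *: "integrable \<pi> (\<lambda>p. f (g p)) \<and> (\<integral>p. f (g p) \<partial>\<pi>) = (\<integral>x. f x \<partial>distr \<pi> borel g)"
    if i: "integrable (distr \<pi> borel g) f" and [measurable]: "g \<in> borel_measurable \<pi>" for g
  proof -
    have "f \<in> borel_measurable borel" using borel_measurable_integrable[OF i] by simp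
    then show ?thesis using integrable_distr[OF that(2) i] integral_distr[OF that(2)] by metis
  qed
  show "integrable \<mu> f \<Longrightarrow> integrable \<pi> (\<lambda>p. f (fst p))"
    "integrable \<mu> f \<Longrightarrow> (\<integral>p. f (fst p) \<partial>\<pi>) = (\<integral>x. f x \<partial>\<mu>)"
    using *[of fst] unfolding d by auto
  show "integrable \<nu> f \<Longrightarrow> integrable \<pi> (\<lambda>p. f (snd p))"
    "integrable \<nu> f \<Longrightarrow> (\<integral>p. f (snd p) \<partial>\<pi>) = (\<integral>x. f x \<partial>\<nu>)"
    using *[of snd] unfolding d by auto
qed

text \<open>This is the easy half of Kantorovich-Rubinstein duality: under any coupling the
  difference of the integrals is the integral of \<open>f x - f y\<close>, which the transport cost
  dominates.\<close>

lemma W1_dist_ge: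
  assumes \<mu>: "\<mu> \<in> W1_space" and \<nu>: "\<nu> \<in> W1_space"
    and f: "\<And>x y. \<bar>f x - f y\<bar> \<le> \<bar>x - y\<bar>" and [measurable]: "f \<in> borel_measurable borel"
  shows "(\<integral>x. f x \<partial>\<mu>) - (\<integral>x. f x \<partial>\<nu>) \<le> W1_dist \<mu> \<nu>"
proof -
  have b: "\<bar>f x\<bar> \<le> \<bar>x\<bar> + \<bar>f 0\<bar>" for x using f[of x 0] by simp
  have i: "integrable \<mu> f" "integrable \<nu> f"
    using integrable_W1_Lipschitz[OF \<mu> assms(4) b] integrable_W1_Lipschitz[OF \<nu> assms(4) b] .
  have "ennreal ((\<integral>x. f x \<partial>\<mu>) - (\<integral>x. f x \<partial>\<nu>)) \<le> W1_cost \<mu> \<nu>"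
    unfolding W1_cost_def
  proof (rule INF_greatest)
    fix \<pi> assume \<pi>: "\<pi> \<in> couplings \<mu> \<nu>"
    note c = couplings_integrable(1)[OF \<pi> i(1)] couplings_integrable(2)[OF \<pi> i(2)]
      couplings_integrable(3)[OF \<pi> i(1)] couplings_integrable(4)[OF \<pi> i(2)]
    have "ennreal ((\<integral>x. f x \<partial>\<mu>) - (\<integral>x. f x \<partial>\<nu>)) \<le> ennreal (norm (\<integral>p. f (fst p) - f (snd p) \<partial>\<pi>))"
      unfolding Bochner_Integration.integral_diff[OF c(1,2)] c(3,4) by (intro ennreal_leI) simp
    also have "\<dots> \<le> (\<integral>\<^sup>+p. norm (f (fst p) - f (snd p)) \<partial>\<pi>)"
      by (intro integral_norm_bound_ennreal Bochner_Integration.integrable_diff c)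
    also have "\<dots> \<le> (\<integral>\<^sup>+ (x, y). ennreal \<bar>x - y\<bar> \<partial>\<pi>)"
      by (intro nn_integral_mono) (auto intro!: ennreal_leI f)
    finally show "ennreal ((\<integral>x. f x \<partial>\<mu>) - (\<integral>x. f x \<partial>\<nu>)) \<le> (\<integral>\<^sup>+ (x, y). ennreal \<bar>x - y\<bar> \<partial>\<pi>)" .
  qed
  then have "enn2real (ennreal ((\<integral>x. f x \<partial>\<mu>) - (\<integral>x. f x \<partial>\<nu>))) \<le> W1_dist \<mu> \<nu>"
    unfolding W1_dist_def using W1_cost_finite[OF \<mu> \<nu>] by (intro enn2real_mono) auto
  \<comment> \<open>\<open>ennreal\<close> sends negative reals to 0, so only this inequality is
    available for a difference of unknown sign.\<close>
  moreover have "r \<le> enn2real (ennreal r)" for r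
    by (cases "0 \<le> r") (auto simp: ennreal_neg)
  ultimately show ?thesis using order_trans by blast
qed

lemma W1_dist_le_coupling:
  assumes \<mu>: "\<mu> \<in> W1_space" and \<nu>: "\<nu> \<in> W1_space" and \<pi>: "\<pi> \<in> couplings \<mu> \<nu>"
  shows "W1_dist \<mu> \<nu> \<le> (\<integral>p. \<bar>fst p - snd p\<bar> \<partial>\<pi>)"
proof -
  have i: "integrable \<pi> (\<lambda>p. \<bar>fst p - snd p\<bar>)"
    using couplings_integrable(1,2)[OF \<pi>, of "\<lambda>x. x"] W1_spaceD(3)[OF \<mu>] W1_spaceD(3)[OF \<nu>]
    by auto
  have "W1_cost \<mu> \<nu> \<le> (\<integral>\<^sup>+ (x, y). ennreal \<bar>x - y\<bar> \<partial>\<pi>)"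
    unfolding W1_cost_def by (rule INF_lower[OF \<pi>])
  also have "\<dots> = ennreal (\<integral>p. \<bar>fst p - snd p\<bar> \<partial>\<pi>)"
    using nn_integral_eq_integral[OF i] by (simp add: case_prod_unfold)
  finally show ?thesis unfolding W1_dist_def by (intro enn2real_leI) auto
qed

text \<open>The joint law of \<open>f\<close> and \<open>g\<close> under \<eta> couples the two
  push-forwards.\<close>

lemma W1_dist_distr_le:
  assumes \<eta>: "\<eta> \<in> W1_space" and W: "distr \<eta> borel f \<in> W1_space" "distr \<eta> borel g \<in> W1_space"
    and [measurable]: "f \<in> borel_measurable borel" "g \<in> borel_measurable borel"
  shows "W1_dist (distr \<eta> borel f) (distr \<eta> borel g) \<le> (\<integral>x. \<bar>f x - g x\<bar> \<partial>\<eta>)"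
proof -
  have [measurable_cong]: "sets \<eta> = sets borel" by (rule W1_spaceD[OF \<eta>])
  define \<pi> where "\<pi> = distr \<eta> (borel \<Otimes>\<^sub>M borel) (\<lambda>x. (f x, g x))"
  have "\<pi> \<in> couplings (distr \<eta> borel f) (distr \<eta> borel g)"
    by (auto simp: couplings_def \<pi>_def distr_distr comp_def
        intro!: prob_space.prob_space_distr[OF W1_spaceD(1)[OF \<eta>]])
  from W1_dist_le_coupling[OF W this] show ?thesis
    by (simp add: \<pi>_def integral_distr)
qed

lemma integrable_W1_abs_diff: "\<mu> \<in> W1_space \<Longrightarrow> integrable \<mu> (\<lambda>x. \<bar>x - t\<bar>)"
  by (rule integrable_W1_Lipschitz[where C = "\<bar>t\<bar>"]) auto

text \<open>The upper bound comes from coupling the identity with a constant map, the lower bound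
  from the test function \<open>\<bar>x - t\<bar>\<close>, which vanishes at
  \<open>t\<close>.\<close>

lemma W1_dist_dirac:
  assumes \<mu>: "\<mu> \<in> W1_space"
  shows "W1_dist \<mu> (dirac t) = (\<integral>x. \<bar>x - t\<bar> \<partial>\<mu>)"
proof (rule antisym)
  have "W1_dist (distr \<mu> borel (\<lambda>x. x)) (distr \<mu> borel (\<lambda>x. t)) \<le> (\<integral>x. \<bar>x - t\<bar> \<partial>\<mu>)"
    by (rule W1_dist_distr_le[OF \<mu>]) (simp_all add: distr_id_W1 distr_const_dirac \<mu> dirac_W1)
  then show "W1_dist \<mu> (dirac t) \<le> (\<integral>x. \<bar>x - t\<bar> \<partial>\<mu>)"
    by (simp add: distr_id_W1 distr_const_dirac \<mu>)
  have "(\<integral>x. \<bar>x - t\<bar> \<partial>\<mu>) - (\<integral>x. \<bar>x - t\<bar> \<partial>dirac t) \<le> W1_dist \<mu> (dirac t)"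
    by (rule W1_dist_ge[OF \<mu> dirac_W1]) (auto simp: abs_if)
  then show "(\<integral>x. \<bar>x - t\<bar> \<partial>\<mu>) \<le> W1_dist \<mu> (dirac t)"
    by (simp add: integral_return)
qed

text \<open>The same coupling and test function work with the roles exchanged, the test function
  changing sign. This serves betweenness relations in which a Dirac measure is an endpoint.\<close>

lemma W1_dist_dirac_commute:
  assumes \<mu>: "\<mu> \<in> W1_space"
  shows "W1_dist (dirac t) \<mu> = W1_dist \<mu> (dirac t)"
proof (rule antisym)
  have "W1_dist (distr \<mu> borel (\<lambda>x. t)) (distr \<mu> borel (\<lambda>x. x)) \<le> (\<integral>x. \<bar>t - x\<bar> \<partial>\<mu>)"
    by (rule W1_dist_distr_le[OF \<mu>]) (simp_all add: distr_id_W1 distr_const_dirac \<mu> dirac_W1)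
  then show "W1_dist (dirac t) \<mu> \<le> W1_dist \<mu> (dirac t)"
    by (simp add: distr_id_W1 distr_const_dirac \<mu> W1_dist_dirac[OF \<mu>] abs_minus_commute)
  have "(\<integral>x. - \<bar>x - t\<bar> \<partial>dirac t) - (\<integral>x. - \<bar>x - t\<bar> \<partial>\<mu>) \<le> W1_dist (dirac t) \<mu>"
    by (rule W1_dist_ge[OF dirac_W1 \<mu>]) (auto simp: abs_if)
  then show "W1_dist \<mu> (dirac t) \<le> W1_dist (dirac t) \<mu>"
    by (simp add: integral_return W1_dist_dirac[OF \<mu>])
qed

lemma W1_dist_dirac_dirac: "W1_dist (dirac s) (dirac t) = \<bar>s - t\<bar>"
  by (simp add: W1_dist_dirac[OF dirac_W1] integral_return)

lemma dirac_inject [simp]: "dirac s = dirac t \<longleftrightarrow> s = t"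
  using W1_dist_dirac_dirac[of s t] W1_dist_dirac_dirac[of t t] by auto

lemma eq_dirac_if_AE:
  assumes \<mu>: "\<mu> \<in> W1_space" and ae: "AE x in \<mu>. x = t"
  shows "\<mu> = dirac t"
proof -
  have [measurable_cong]: "sets \<mu> = sets borel" by (rule W1_spaceD[OF \<mu>])
  have "distr \<mu> borel (\<lambda>x. x) = distr \<mu> borel (\<lambda>x. t)"
    using ae by (intro distr_cong_AE) auto
  then show ?thesis using \<mu> by (simp add: distr_id_W1 distr_const_dirac)
qed

section \<open>Distances to Dirac measures determine a measure\<close>

text \<open>These are right difference quotients at \<open>t\<close> with step
  \<open>1 / real (Suc n)\<close>. Under the integral they are bounded by 1 and converge to 1 for
  \<open>x \<le> t\<close> and to -1 for \<open>x > t\<close>, so dominated convergence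
  applies.\<close>

lemma W1_cdf_limit:
  assumes \<mu>: "\<mu> \<in> W1_space"
  shows "(\<lambda>n. real (Suc n) * ((\<integral>x. \<bar>x - (t + 1 / real (Suc n))\<bar> \<partial>\<mu>) - (\<integral>x. \<bar>x - t\<bar> \<partial>\<mu>)))
    \<longlonglongrightarrow> 2 * cdf \<mu> t - 1"
proof -
  interpret prob_space \<mu> by (rule W1_spaceD[OF \<mu>])
  have [measurable_cong]: "sets \<mu> = sets borel" by (rule W1_spaceD[OF \<mu>])
  have sp [simp]: "space \<mu> = UNIV" by (rule W1_spaceD[OF \<mu>])
  define g where
    "g n x = real (Suc n) * (\<bar>x - (t + 1 / real (Suc n))\<bar> - \<bar>x - t\<bar>)" for n and x :: real
  have "(\<lambda>n. \<integral>x. g n x \<partial>\<mu>) \<longlonglongrightarrow> (\<integral>x. 2 * indicator {..t} x - 1 \<partial>\<mu>)"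
  proof (rule integral_dominated_convergence[where w = "\<lambda>_. 1"])
    show "AE x in \<mu>. (\<lambda>n. g n x) \<longlonglongrightarrow> 2 * indicator {..t} x - 1"
    proof (rule AE_I2)
      fix x
      show "(\<lambda>n. g n x) \<longlonglongrightarrow> 2 * indicator {..t} x - 1"
      proof (cases "x \<le> t")
        case True
        have "g n x = 1" for n
        proof -
          have "0 < 1 / real (Suc n)" by simp
          with True have "\<bar>x - (t + 1 / real (Suc n))\<bar> = 1 / real (Suc n) + (t - x)" by linarith
          then show ?thesis using True by (simp add: g_def)
        qed
        then show ?thesis using True by simp
      next
        case False
        \<comment> \<open>From some index on, \<open>t\<close> and the shifted point both lie to the
          left of \<open>x\<close>, and the quotient is exactly -1.\<close>
        have "eventually (\<lambda>n. 1 / real (Suc n) < x - t) sequentially"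
          using LIMSEQ_inverse_real_of_nat False
          by (intro order_tendstoD(2)) (auto simp: divide_inverse)
        then have "eventually (\<lambda>n. g n x = -1) sequentially"
        proof eventually_elim
          case (elim n)
          then have "\<bar>x - (t + 1 / real (Suc n))\<bar> = x - t - 1 / real (Suc n)" by simp
          then show ?case using False by (simp add: g_def)
        qed
        then show ?thesis using False by (simp add: tendsto_eventually)
      qed
    qed
    show "AE x in \<mu>. norm (g n x) \<le> 1" for n
    proof (rule AE_I2)
      fix x
      have "0 < 1 / real (Suc n)" by simp
      then have "\<bar>\<bar>x - (t + 1 / real (Suc n))\<bar> - \<bar>x - t\<bar>\<bar> \<le> 1 / real (Suc n)" by linarith
      then have "real (Suc n) * \<bar>\<bar>x - (t + 1 / real (Suc n))\<bar> - \<bar>x - t\<bar>\<bar> \<le> real (Suc n) * (1 / real (Suc n))"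
        by (rule mult_left_mono) simp
      then show "norm (g n x) \<le> 1"
        by (simp add: g_def abs_mult del: of_nat_Suc)
    qed
  qed (auto simp: g_def)
  moreover have "(\<integral>x. g n x \<partial>\<mu>) =
      real (Suc n) * ((\<integral>x. \<bar>x - (t + 1 / real (Suc n))\<bar> \<partial>\<mu>) - (\<integral>x. \<bar>x - t\<bar> \<partial>\<mu>))" for n
    unfolding g_def using integrable_W1_abs_diff[OF \<mu>] by simp
  moreover have "(\<integral>x. 2 * indicator {..t} x - 1 \<partial>\<mu>) = 2 * cdf \<mu> t - 1"
  proof -
    have "integrable \<mu> (indicator {..t} :: real \<Rightarrow> real)"
      by (rule integrable_real_indicator) (simp_all add: W1_spaceD(2)[OF \<mu>] emeasure_eq_measure)
    then show ?thesis using prob_space by (simp add: cdf_def)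
  qed
  ultimately show ?thesis by simp
qed

lemma W1_eq_if_dist_dirac_eq:
  assumes \<mu>: "\<mu> \<in> W1_space" and \<nu>: "\<nu> \<in> W1_space"
    and eq: "\<And>t. W1_dist \<mu> (dirac t) = W1_dist \<nu> (dirac t)"
  shows "\<mu> = \<nu>"
proof (rule cdf_unique)
  have rd: "real_distribution \<rho>" if "\<rho> \<in> W1_space" for \<rho>
    using W1_spaceD[OF that]
    by (auto simp: real_distribution_def real_distribution_axioms_def)
  show "real_distribution \<mu>" "real_distribution \<nu>" using rd \<mu> \<nu> by auto
  show "cdf \<mu> = cdf \<nu>"
  proof
    fix t
    have "(\<integral>x. \<bar>x - s\<bar> \<partial>\<mu>) = (\<integral>x. \<bar>x - s\<bar> \<partial>\<nu>)" for s
      using eq[of s] by (simp add: W1_dist_dirac \<mu> \<nu>)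
    then have "2 * cdf \<mu> t - 1 = 2 * cdf \<nu> t - 1"
      using LIMSEQ_unique[OF W1_cdf_limit[OF \<mu>]] W1_cdf_limit[OF \<nu>] by simp
    then show "cdf \<mu> t = cdf \<nu> t" by simp
  qed
qed

section \<open>A metric characterisation of Dirac measures\<close>

text \<open>By the triangle inequality this amounts to equality, so that \<eta> lies on a metric
  segment. Placing \<eta> second gives the distances the form treated in
  \<open>W1_dist_dirac\<close> when \<eta> is a Dirac measure.\<close>

definition W1_between :: "real measure \<Rightarrow> real measure \<Rightarrow> real measure \<Rightarrow> bool" where
  "W1_between \<eta> \<mu> \<nu> \<longleftrightarrow> W1_dist \<mu> \<eta> + W1_dist \<nu> \<eta> \<le> W1_dist \<mu> \<nu>"

text \<open>The product coupling costs at least \<open>W1_dist \<mu> \<nu>\<close>, so the excess in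
  the triangle inequality through \<open>t\<close> has integral at most 0. Being nonnegative, it
  vanishes almost everywhere.\<close>

lemma dirac_between_AE:
  assumes \<mu>: "\<mu> \<in> W1_space" and \<nu>: "\<nu> \<in> W1_space" and btw: "W1_between (dirac t) \<mu> \<nu>"
  shows "AE p in \<mu> \<Otimes>\<^sub>M \<nu>. \<bar>fst p - t\<bar> + \<bar>snd p - t\<bar> = \<bar>fst p - snd p\<bar>"
proof -
  have \<pi>: "\<mu> \<Otimes>\<^sub>M \<nu> \<in> couplings \<mu> \<nu>" by (rule product_coupling[OF \<mu> \<nu>])
  note c = couplings_integrable[OF \<pi>, of "\<lambda>x. \<bar>x - t\<bar>"] couplings_integrable[OF \<pi>, of "\<lambda>x. x"]
  note i = integrable_W1_abs_diff[OF \<mu>] integrable_W1_abs_diff[OF \<nu>]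
    W1_spaceD(3)[OF \<mu>] W1_spaceD(3)[OF \<nu>]
  define g where "g p = \<bar>fst p - t\<bar> + \<bar>snd p - t\<bar> - \<bar>fst p - snd p\<bar>" for p :: "real \<times> real"
  have g: "integrable (\<mu> \<Otimes>\<^sub>M \<nu>) g" unfolding g_def using c i by simp
  have nn: "0 \<le> g p" for p unfolding g_def by (simp add: abs_if)
  have "(\<integral>p. g p \<partial>(\<mu> \<Otimes>\<^sub>M \<nu>))
      = (\<integral>x. \<bar>x - t\<bar> \<partial>\<mu>) + (\<integral>x. \<bar>x - t\<bar> \<partial>\<nu>) - (\<integral>p. \<bar>fst p - snd p\<bar> \<partial>(\<mu> \<Otimes>\<^sub>M \<nu>))"
    unfolding g_def using c i by simp
  also have "\<dots> \<le> 0"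
    using W1_dist_le_coupling[OF \<mu> \<nu> \<pi>] btw by (simp add: W1_between_def W1_dist_dirac \<mu> \<nu>)
  finally have "(\<integral>p. g p \<partial>(\<mu> \<Otimes>\<^sub>M \<nu>)) = 0"
    using nn by (intro antisym integral_nonneg_AE) auto
  then have "AE p in \<mu> \<Otimes>\<^sub>M \<nu>. g p = 0"
    using integral_nonneg_eq_0_iff_AE[OF g] nn by simp
  then show ?thesis by eventually_elim (simp add: g_def)
qed

text \<open>For two points strictly on the same side of \<open>t\<close> the triangle inequality
  through \<open>t\<close> is strict. Hence the square of \<open>S\<close> is a null set of the
  product, whose mass there is the product of the masses of \<open>S\<close>.\<close>

lemma dirac_between_null:
  assumes \<mu>: "\<mu> \<in> W1_space" and \<nu>: "\<nu> \<in> W1_space" and btw: "W1_between (dirac t) \<mu> \<nu>"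
    and S: "S = {..<t} \<or> S = {t<..}"
  shows "emeasure \<mu> S = 0 \<or> emeasure \<nu> S = 0"
proof -
  interpret M: prob_space \<mu> by (rule W1_spaceD[OF \<mu>])
  interpret N: prob_space \<nu> by (rule W1_spaceD[OF \<nu>])
  have sets: "S \<in> sets \<mu>" "S \<in> sets \<nu>" using S unfolding W1_spaceD(2)[OF \<mu>] W1_spaceD(2)[OF \<nu>] by auto
  have "AE p in \<mu> \<Otimes>\<^sub>M \<nu>. p \<notin> S \<times> S"
    using dirac_between_AE[OF \<mu> \<nu> btw]
  proof eventually_elim
    case (elim p)
    have "(fst p < t \<longrightarrow> t \<le> snd p) \<and> (t < fst p \<longrightarrow> snd p \<le> t)" using elim by linarith
    then show ?case using S by auto
  qed
  then have "S \<times> S \<in> null_sets (\<mu> \<Otimes>\<^sub>M \<nu>)"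
    using AE_iff_null_sets[OF pair_measureI[OF sets]] by blast
  then have "emeasure (\<mu> \<Otimes>\<^sub>M \<nu>) (S \<times> S) = 0" by (rule null_setsD1)
  then show ?thesis using N.emeasure_pair_measure_Times[OF sets] by simp
qed

lemma not_dirac_charges_side:
  assumes \<mu>: "\<mu> \<in> W1_space" and "\<mu> \<noteq> dirac t"
  shows "emeasure \<mu> {..<t} \<noteq> 0 \<or> emeasure \<mu> {t<..} \<noteq> 0"
proof (rule ccontr)
  assume "\<not> ?thesis"
  then have "{..<t} \<in> null_sets \<mu>" "{t<..} \<in> null_sets \<mu>"
    using W1_spaceD(2)[OF \<mu>] by (auto simp: null_sets_def)
  from AE_not_in[OF this(1)] AE_not_in[OF this(2)] have "AE x in \<mu>. x = t"
    by eventually_elim auto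
  then show False using eq_dirac_if_AE[OF \<mu>] assms(2) by blast
qed

text \<open>A point pairwise between three others is a median of them; here only trivial triples,
  those containing \<eta>, may have \<eta> as a median. The notion is purely metric.\<close>

definition W1_median_irreducible :: "real measure \<Rightarrow> bool" where
  "W1_median_irreducible \<eta> \<longleftrightarrow> (\<forall>\<mu>\<in>W1_space. \<forall>\<nu>\<in>W1_space. \<forall>\<rho>\<in>W1_space.
    W1_between \<eta> \<mu> \<nu> \<longrightarrow> W1_between \<eta> \<nu> \<rho> \<longrightarrow> W1_between \<eta> \<mu> \<rho> \<longrightarrow> \<eta> \<in> {\<mu>, \<nu>, \<rho>})"

lemma W1_median_irreducible_dirac: "W1_median_irreducible (dirac t)"
  unfolding W1_median_irreducible_def
proof (intro ballI impI)
  fix \<mu> \<nu> \<rho> assume W: "\<mu> \<in> W1_space" "\<nu> \<in> W1_space" "\<rho> \<in> W1_space"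
    and b: "W1_between (dirac t) \<mu> \<nu>" "W1_between (dirac t) \<nu> \<rho>" "W1_between (dirac t) \<mu> \<rho>"
  show "dirac t \<in> {\<mu>, \<nu>, \<rho>}"
    \<comment> \<open>If all three differ from \<open>dirac t\<close>, each charges one of two
      half-lines, so two of them charge the same one, which betweenness forbids.\<close>
    using not_dirac_charges_side[OF W(1), of t] not_dirac_charges_side[OF W(2), of t]
      not_dirac_charges_side[OF W(3), of t]
      dirac_between_null[OF W(1,2) b(1)] dirac_between_null[OF W(2,3) b(2)]
      dirac_between_null[OF W(1,3) b(3)]
    by blast
qed

text \<open>Without mass on one side, \<open>x - c\<close> has constant sign almost everywhere; its
  integral is 0, so \<eta> would be concentrated at \<open>c\<close>.\<close>

lemma charges_both_sides_of_mean:
  assumes \<eta>: "\<eta> \<in> W1_space" and nd: "\<And>t. \<eta> \<noteq> dirac t" and c: "c = (\<integral>x. x \<partial>\<eta>)"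
  shows "0 < measure \<eta> {..<c}" "0 < measure \<eta> {c..}"
proof -
  interpret prob_space \<eta> by (rule W1_spaceD[OF \<eta>])
  have s: "sets \<eta> = sets borel" by (rule W1_spaceD[OF \<eta>])
  have i: "integrable \<eta> (\<lambda>x. x - c)" using W1_spaceD(3)[OF \<eta>] by simp
  have I: "(\<integral>x. x - c \<partial>\<eta>) = 0" using W1_spaceD(3)[OF \<eta>] by (simp add: c prob_space)
  have False if z: "measure \<eta> {..<c} = 0 \<or> measure \<eta> {c..} = 0"
  proof -
    have "AE x in \<eta>. x - c = 0"
      using z
    proof
      assume "measure \<eta> {..<c} = 0"
      then have "{..<c} \<in> null_sets \<eta>" by (auto simp: null_sets_def emeasure_eq_measure s)
      then have "AE x in \<eta>. 0 \<le> x - c" using AE_not_in by force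
      then show ?thesis using integral_nonneg_eq_0_iff_AE[OF i] I by simp
    next
      assume "measure \<eta> {c..} = 0"
      then have "{c..} \<in> null_sets \<eta>" by (auto simp: null_sets_def emeasure_eq_measure s)
      then have ae: "AE x in \<eta>. 0 \<le> c - x" using AE_not_in by force
      have "integrable \<eta> (\<lambda>x. c - x)" "(\<integral>x. c - x \<partial>\<eta>) = 0"
        using W1_spaceD(3)[OF \<eta>] by (simp_all add: c prob_space)
      then have "AE x in \<eta>. c - x = 0" using integral_nonneg_eq_0_iff_AE[OF _ ae] by blast
      then show ?thesis by eventually_elim simp
    qed
    then show False using eq_dirac_if_AE[OF \<eta>, of c] nd by simp
  qed
  then show "0 < measure \<eta> {..<c}" "0 < measure \<eta> {c..}"
    by (auto simp: zero_less_measure_iff)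
qed

lemma dirac_if_W1_median_irreducible:
  assumes \<eta>: "\<eta> \<in> W1_space" and irr: "W1_median_irreducible \<eta>"
  shows "\<exists>t. \<eta> = dirac t"
proof (rule ccontr)
  assume "\<not> ?thesis"
  then have nd: "\<And>t. \<eta> \<noteq> dirac t" by blast
  interpret prob_space \<eta> by (rule W1_spaceD[OF \<eta>])
  have s [measurable_cong]: "sets \<eta> = sets borel" by (rule W1_spaceD[OF \<eta>])
  have id: "integrable \<eta> (\<lambda>x. x)" by (rule W1_spaceD[OF \<eta>])
  have [simp]: "space \<eta> = UNIV" by (rule W1_spaceD[OF \<eta>])
  define c where "c = (\<integral>x. x \<partial>\<eta>)"
  define a where "a = measure \<eta> {..<c}"
  define b where "b = measure \<eta> {c..}"
  have ab: "0 < a" "0 < b" using charges_both_sides_of_mean[OF \<eta> nd c_def] by (auto simp: a_def b_def)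
  \<comment> \<open>\<open>L\<close> and \<open>R\<close> shift by one unit away from
    \<open>c\<close>, so their transport costs are at most the shifted masses \<open>a\<close> and
    \<open>b\<close>.\<close>
  define L where "L x = x - indicator {..<c} x" for x :: real
  define R where "R x = x + indicator {c..} x" for x :: real
  have [measurable]: "L \<in> borel_measurable borel" "R \<in> borel_measurable borel"
    unfolding L_def R_def by measurable
  have L: "distr \<eta> borel L \<in> W1_space" (is "?\<mu> \<in> _")
    by (rule distr_W1[OF \<eta>, where C = 1]) (auto simp: L_def indicator_def)
  have R: "distr \<eta> borel R \<in> W1_space" (is "?\<nu> \<in> _")
    by (rule distr_W1[OF \<eta>, where C = 1]) (auto simp: R_def indicator_def)
  have iS: "integrable \<eta> (indicator {..<c} :: real \<Rightarrow> real)"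
    "integrable \<eta> (indicator {c..} :: real \<Rightarrow> real)"
    by (rule integrable_real_indicator; simp add: s emeasure_eq_measure)+
  have iD: "integrable \<eta> (\<lambda>x. \<bar>x - c\<bar>)" by (rule integrable_W1_abs_diff[OF \<eta>])
  have [measurable]: "L \<in> borel_measurable \<eta>" "R \<in> borel_measurable \<eta>"
    by (simp_all add: W1_spaceD(5)[OF \<eta>])
  have mL: "(\<integral>x. x \<partial>?\<mu>) = c - a"
  proof -
    have "(\<integral>x. x \<partial>?\<mu>) = (\<integral>x. L x \<partial>\<eta>)" by (rule integral_distr) auto
    also have "\<dots> = c - a" unfolding L_def using id iS by (simp add: c_def[symmetric] a_def)
    finally show ?thesis .
  qed
  have mR: "(\<integral>x. x \<partial>?\<nu>) = c + b"
  proof -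
    have "(\<integral>x. x \<partial>?\<nu>) = (\<integral>x. R x \<partial>\<eta>)" by (rule integral_distr) auto
    also have "\<dots> = c + b" unfolding R_def using id iS by (simp add: c_def[symmetric] b_def)
    finally show ?thesis .
  qed
  have dL: "W1_dist ?\<mu> \<eta> \<le> a"
  proof -
    have "W1_dist ?\<mu> (distr \<eta> borel (\<lambda>x. x)) \<le> (\<integral>x. \<bar>L x - x\<bar> \<partial>\<eta>)"
      by (rule W1_dist_distr_le[OF \<eta> L]) (simp_all add: distr_id_W1 \<eta>)
    also have "\<dots> = a" by (simp add: L_def a_def)
    finally show ?thesis by (simp add: distr_id_W1 \<eta>)
  qed
  have dR: "W1_dist ?\<nu> \<eta> \<le> b"
  proof -
    have "W1_dist ?\<nu> (distr \<eta> borel (\<lambda>x. x)) \<le> (\<integral>x. \<bar>R x - x\<bar> \<partial>\<eta>)"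
      by (rule W1_dist_distr_le[OF \<eta> R]) (simp_all add: distr_id_W1 \<eta>)
    also have "\<dots> = b" by (simp add: R_def b_def)
    finally show ?thesis by (simp add: distr_id_W1 \<eta>)
  qed
  \<comment> \<open>The test function \<open>- x\<close> bounds the distance below by the difference
    of the means, \<open>(c + b) - (c - a)\<close>.\<close>
  have "(\<integral>x. - x \<partial>?\<mu>) - (\<integral>x. - x \<partial>?\<nu>) \<le> W1_dist ?\<mu> ?\<nu>"
    by (rule W1_dist_ge[OF L R]) auto
  then have "a + b \<le> W1_dist ?\<mu> ?\<nu>" using mL mR by simp
  then have 1: "W1_between \<eta> ?\<mu> ?\<nu>" using dL dR by (simp add: W1_between_def)
  \<comment> \<open>Since \<open>L\<close> moves points away from \<open>c\<close>, the distance to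
    \<open>dirac c\<close> grows by the full shifted mass \<open>a\<close>. The same happens for
    \<open>R\<close> with \<open>b\<close>.\<close>
  have "W1_dist ?\<mu> (dirac c) = (\<integral>x. \<bar>x - c\<bar> + indicator {..<c} x \<partial>\<eta>)"
  proof -
    have "\<bar>L x - c\<bar> = \<bar>x - c\<bar> + indicator {..<c} x" for x
      by (cases "x < c") (simp_all add: L_def)
    then show ?thesis by (simp add: W1_dist_dirac[OF L] integral_distr)
  qed
  also have "\<dots> = W1_dist \<eta> (dirac c) + a"
    using iD iS by (simp add: W1_dist_dirac[OF \<eta>] a_def)
  finally have 2: "W1_between \<eta> ?\<mu> (dirac c)"
    using dL by (simp add: W1_between_def W1_dist_dirac_commute[OF \<eta>])
  have "W1_dist ?\<nu> (dirac c) = (\<integral>x. \<bar>x - c\<bar> + indicator {c..} x \<partial>\<eta>)"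
  proof -
    have "\<bar>R x - c\<bar> = \<bar>x - c\<bar> + indicator {c..} x" for x
      by (cases "x < c") (simp_all add: R_def)
    then show ?thesis by (simp add: W1_dist_dirac[OF R] integral_distr)
  qed
  also have "\<dots> = W1_dist \<eta> (dirac c) + b"
    using iD iS by (simp add: W1_dist_dirac[OF \<eta>] b_def)
  finally have 3: "W1_between \<eta> ?\<nu> (dirac c)"
    using dR by (simp add: W1_between_def W1_dist_dirac_commute[OF \<eta>])
  have "\<eta> \<in> {?\<mu>, ?\<nu>, dirac c}"
    using irr[unfolded W1_median_irreducible_def, rule_format, OF L R dirac_W1 1 3 2] .
  \<comment> \<open>Both shifts change the mean, because \<open>a\<close> and \<open>b\<close> are
    positive.\<close>
  moreover have "\<eta> \<noteq> ?\<mu>" "\<eta> \<noteq> ?\<nu>" using mL mR ab c_def by auto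
  ultimately show False using nd by blast
qed

lemma W1_median_irreducible_isometry:
  assumes \<phi>: "bij_betw \<phi> W1_space W1_space"
    and iso: "\<And>\<mu> \<nu>. \<mu> \<in> W1_space \<Longrightarrow> \<nu> \<in> W1_space \<Longrightarrow> W1_dist (\<phi> \<mu>) (\<phi> \<nu>) = W1_dist \<mu> \<nu>"
    and \<eta>: "\<eta> \<in> W1_space"
  shows "W1_median_irreducible (\<phi> \<eta>) \<longleftrightarrow> W1_median_irreducible \<eta>"
proof -
  have im: "\<phi> ` W1_space = W1_space" and inj: "inj_on \<phi> W1_space"
    using \<phi> by (auto simp: bij_betw_def)
  have eq: "\<phi> \<eta> = \<phi> \<mu> \<longleftrightarrow> \<eta> = \<mu>" if "\<mu> \<in> W1_space" for \<mu>
    using inj_on_eq_iff[OF inj \<eta> that] .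
  have btw: "W1_between (\<phi> \<eta>) (\<phi> \<mu>) (\<phi> \<nu>) \<longleftrightarrow> W1_between \<eta> \<mu> \<nu>"
    if "\<mu> \<in> W1_space" "\<nu> \<in> W1_space" for \<mu> \<nu>
    using that \<eta> by (simp add: W1_between_def iso)
  \<comment> \<open>Surjectivity lets the quantifiers run over images; betweenness and equality then
    pull back through \<phi>.\<close>
  have "W1_median_irreducible (\<phi> \<eta>) \<longleftrightarrow>
    (\<forall>\<mu>\<in>\<phi> ` W1_space. \<forall>\<nu>\<in>\<phi> ` W1_space. \<forall>\<rho>\<in>\<phi> ` W1_space. W1_between (\<phi> \<eta>) \<mu> \<nu> \<longrightarrow>
      W1_between (\<phi> \<eta>) \<nu> \<rho> \<longrightarrow> W1_between (\<phi> \<eta>) \<mu> \<rho> \<longrightarrow> \<phi> \<eta> \<in> {\<mu>, \<nu>, \<rho>})"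
    unfolding im W1_median_irreducible_def ..
  also have "\<dots> \<longleftrightarrow> W1_median_irreducible \<eta>"
    by (simp add: W1_median_irreducible_def btw eq)
  finally show ?thesis .
qed

section \<open>Isometries of the Wasserstein space\<close>

lemma Isom_real_iff:
  "\<psi> \<in> Isom (UNIV :: real set) dist \<longleftrightarrow> surj \<psi> \<and> (\<forall>x y. \<bar>\<psi> x - \<psi> y\<bar> = \<bar>x - y\<bar>)"
  by (simp add: Isom_def dist_real_def)

lemma Isom_realD:
  assumes "\<psi> \<in> Isom (UNIV :: real set) dist"
  shows "surj \<psi>" "inj \<psi>" "\<bar>\<psi> x - \<psi> y\<bar> = \<bar>x - y\<bar>" "\<psi> \<in> borel_measurable borel"
proof -
  show 1: "surj \<psi>" and 2: "\<bar>\<psi> x - \<psi> y\<bar> = \<bar>x - y\<bar>" for x y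
    using assms by (auto simp: Isom_real_iff)
  show "inj \<psi>" using 2 by (metis abs_0_eq eq_iff_diff_eq_0 injI)
  have "continuous_on UNIV \<psi>"
    unfolding continuous_on_iff dist_real_def using 2 by auto
  then show "\<psi> \<in> borel_measurable borel" by (rule borel_measurable_continuous_onI)
qed

lemma Isom_real_inv:
  assumes "\<psi> \<in> Isom (UNIV :: real set) dist"
  shows "inv_into UNIV \<psi> \<in> Isom (UNIV :: real set) dist"
  using Isom_realD(1,2)[OF assms] Isom_realD(3)[OF assms, of "inv_into UNIV \<psi> _" "inv_into UNIV \<psi> _"]
  by (auto simp: Isom_real_iff inj_imp_surj_inv surj_f_inv_f)

lemma distr_Isom_W1:
  assumes \<psi>: "\<psi> \<in> Isom (UNIV :: real set) dist" and \<mu>: "\<mu> \<in> W1_space"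
  shows "distr \<mu> borel \<psi> \<in> W1_space"
proof (rule distr_W1[OF \<mu> Isom_realD(4)[OF \<psi>]])
  show "\<bar>\<psi> x\<bar> \<le> \<bar>x\<bar> + \<bar>\<psi> 0\<bar>" for x using Isom_realD(3)[OF \<psi>, of x 0] by simp
qed

section \<open>Every isometry is a push-forward\<close>

lemma W1_isometry_distr:
  assumes \<phi>: "bij_betw \<phi> W1_space W1_space"
    and iso: "\<And>\<mu> \<nu>. \<mu> \<in> W1_space \<Longrightarrow> \<nu> \<in> W1_space \<Longrightarrow> W1_dist (\<phi> \<mu>) (\<phi> \<nu>) = W1_dist \<mu> \<nu>"
  shows "\<exists>\<psi>\<in>Isom (UNIV :: real set) dist. \<forall>\<mu>\<in>W1_space. \<phi> \<mu> = distr \<mu> borel \<psi>"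
proof -
  have in_W: "\<phi> \<mu> \<in> W1_space" if "\<mu> \<in> W1_space" for \<mu> using \<phi> that by (auto simp: bij_betw_def)
  have "\<exists>s. \<phi> (dirac t) = dirac s" for t
    using W1_median_irreducible_isometry[OF \<phi> iso dirac_W1] W1_median_irreducible_dirac
    by (intro dirac_if_W1_median_irreducible in_W dirac_W1) auto
  then obtain \<psi> where \<psi>: "\<And>t. \<phi> (dirac t) = dirac (\<psi> t)" by metis
  have "\<bar>\<psi> x - \<psi> y\<bar> = \<bar>x - y\<bar>" for x y
    using iso[OF dirac_W1 dirac_W1, of x y] by (simp add: \<psi> W1_dist_dirac_dirac)
  \<comment> \<open>The preimage of a Dirac measure is again irreducible, hence Dirac.\<close>
  moreover have surj: "\<exists>t. s = \<psi> t" for s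
  proof -
    have "dirac s \<in> \<phi> ` W1_space" using \<phi> dirac_W1 by (simp add: bij_betw_def)
    then obtain \<eta> where \<eta>: "\<eta> \<in> W1_space" "\<phi> \<eta> = dirac s" by (metis imageE)
    then have "W1_median_irreducible \<eta>"
      using W1_median_irreducible_isometry[OF \<phi> iso \<eta>(1)] W1_median_irreducible_dirac by simp
    then obtain t where "\<eta> = dirac t" using dirac_if_W1_median_irreducible[OF \<eta>(1)] by blast
    then show ?thesis using \<eta>(2) \<psi>[of t] by auto
  qed
  ultimately have Isom: "\<psi> \<in> Isom UNIV dist" by (auto simp: Isom_real_iff surj_def)
  have "\<phi> \<mu> = distr \<mu> borel \<psi>" if \<mu>: "\<mu> \<in> W1_space" for \<mu>
  proof (rule W1_eq_if_dist_dirac_eq[OF in_W[OF \<mu>] distr_Isom_W1[OF Isom \<mu>]])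
    fix s
    \<comment> \<open>Writing the base point as an image under \<psi> allows the isometry property
      of \<phi> to be used at \<open>dirac t\<close>.\<close>
    obtain t where t: "s = \<psi> t" using surj by blast
    have [measurable]: "\<psi> \<in> borel_measurable borel" "\<psi> \<in> borel_measurable \<mu>"
      using Isom_realD(4)[OF Isom] by (simp_all add: W1_spaceD(5)[OF \<mu>])
    have "W1_dist (\<phi> \<mu>) (dirac s) = (\<integral>x. \<bar>x - t\<bar> \<partial>\<mu>)"
      using iso[OF \<mu> dirac_W1, of t] by (simp add: \<psi> t W1_dist_dirac[OF \<mu>])
    also have "\<dots> = W1_dist (distr \<mu> borel \<psi>) (dirac s)"
      by (simp add: W1_dist_dirac[OF distr_Isom_W1[OF Isom \<mu>]] integral_distr t Isom_realD(3)[OF Isom])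
    finally show "W1_dist (\<phi> \<mu>) (dirac s) = W1_dist (distr \<mu> borel \<psi>) (dirac s)" .
  qed
  with Isom show ?thesis by blast
qed

section \<open>Push-forwards along isometries of the line\<close>

text \<open>Applying \<psi> to both coordinates turns a coupling of the original measures into one
  of the images, at no greater cost.\<close>

lemma W1_cost_distr_le:
  assumes [measurable]: "\<psi> \<in> borel_measurable borel" and \<psi>: "\<And>x y. \<bar>\<psi> x - \<psi> y\<bar> \<le> \<bar>x - y\<bar>"
  shows "W1_cost (distr \<mu> borel \<psi>) (distr \<nu> borel \<psi>) \<le> W1_cost \<mu> \<nu>"
  unfolding W1_cost_def[of \<mu> \<nu>]
proof (rule INF_greatest)
  fix \<pi> assume \<pi>: "\<pi> \<in> couplings \<mu> \<nu>"
  then have [measurable_cong]: "sets \<pi> = sets (borel \<Otimes>\<^sub>M borel)" and "prob_space \<pi>"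
    and m: "\<mu> = distr \<pi> borel fst" "\<nu> = distr \<pi> borel snd"
    by (auto simp: couplings_def)
  define \<rho> where "\<rho> = distr \<pi> (borel \<Otimes>\<^sub>M borel) (\<lambda>p. (\<psi> (fst p), \<psi> (snd p)))"
  have "\<rho> \<in> couplings (distr \<mu> borel \<psi>) (distr \<nu> borel \<psi>)"
    unfolding m using \<open>prob_space \<pi>\<close>
    by (auto simp: couplings_def \<rho>_def distr_distr comp_def intro!: prob_space.prob_space_distr)
  then have "W1_cost (distr \<mu> borel \<psi>) (distr \<nu> borel \<psi>) \<le> (\<integral>\<^sup>+ (x, y). ennreal \<bar>x - y\<bar> \<partial>\<rho>)"
    unfolding W1_cost_def by (rule INF_lower)
  also have "\<dots> = (\<integral>\<^sup>+ p. ennreal \<bar>\<psi> (fst p) - \<psi> (snd p)\<bar> \<partial>\<pi>)"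
    unfolding \<rho>_def by (subst nn_integral_distr) (auto simp: split_beta)
  also have "\<dots> \<le> (\<integral>\<^sup>+ (x, y). ennreal \<bar>x - y\<bar> \<partial>\<pi>)"
    using \<psi> by (intro nn_integral_mono) (auto intro!: ennreal_leI)
  finally show "W1_cost (distr \<mu> borel \<psi>) (distr \<nu> borel \<psi>) \<le> (\<integral>\<^sup>+ (x, y). ennreal \<bar>x - y\<bar> \<partial>\<pi>)" .
qed

lemma distr_Isom_inv:
  assumes \<psi>: "\<psi> \<in> Isom (UNIV :: real set) dist" and \<mu>: "\<mu> \<in> W1_space"
  shows "distr (distr \<mu> borel (inv_into UNIV \<psi>)) borel \<psi> = \<mu>" "distr (distr \<mu> borel \<psi>) borel (inv_into UNIV \<psi>) = \<mu>"
  using Isom_realD[OF \<psi>] Isom_realD[OF Isom_real_inv[OF \<psi>]]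
  by (simp_all add: distr_distr W1_spaceD(5)[OF \<mu>] comp_def surj_f_inv_f distr_id_W1[OF \<mu>])

lemma W1_dist_distr_Isom:
  assumes \<psi>: "\<psi> \<in> Isom (UNIV :: real set) dist" and \<mu>: "\<mu> \<in> W1_space" and \<nu>: "\<nu> \<in> W1_space"
  shows "W1_dist (distr \<mu> borel \<psi>) (distr \<nu> borel \<psi>) = W1_dist \<mu> \<nu>"
proof -
  have le: "W1_cost (distr \<mu> borel \<tau>) (distr \<nu> borel \<tau>) \<le> W1_cost \<mu> \<nu>"
    if "\<tau> \<in> Isom (UNIV :: real set) dist" for \<tau> \<mu> \<nu>
    using Isom_realD[OF that] by (intro W1_cost_distr_le) auto
  \<comment> \<open>The reverse inequality is the contraction property of the inverse isometry,
    applied to the push-forwards.\<close>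
  have "W1_cost (distr \<mu> borel \<psi>) (distr \<nu> borel \<psi>) = W1_cost \<mu> \<nu>"
    using le[OF \<psi>] le[OF Isom_real_inv[OF \<psi>], of "distr \<mu> borel \<psi>" "distr \<nu> borel \<psi>"]
    by (intro antisym) (simp_all add: distr_Isom_inv[OF \<psi>] \<mu> \<nu>)
  then show ?thesis by (simp add: W1_dist_def)
qed

lemma W1_push_Isom:
  assumes \<psi>: "\<psi> \<in> Isom (UNIV :: real set) dist"
  shows "W1_push \<psi> \<in> Isom W1_space W1_dist"
proof -
  have W: "W1_push \<psi> \<mu> = distr \<mu> borel \<psi>" if "\<mu> \<in> W1_space" for \<mu>
    using that by (simp add: W1_push_def)
  have "W1_push \<psi> ` W1_space = W1_space"
  proof (rule antisym)
    show "W1_push \<psi> ` W1_space \<subseteq> W1_space"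
      by (rule image_subsetI) (simp add: W distr_Isom_W1[OF \<psi>])
    show "W1_space \<subseteq> W1_push \<psi> ` W1_space"
    proof
      fix \<mu> assume \<mu>: "\<mu> \<in> W1_space"
      have "distr \<mu> borel (inv_into UNIV \<psi>) \<in> W1_space"
        by (rule distr_Isom_W1[OF Isom_real_inv[OF \<psi>] \<mu>])
      moreover from this have "\<mu> = W1_push \<psi> (distr \<mu> borel (inv_into UNIV \<psi>))"
        by (simp add: W distr_Isom_inv(1)[OF \<psi> \<mu>])
      ultimately show "\<mu> \<in> W1_push \<psi> ` W1_space" by (rule rev_image_eqI)
    qed
  qed
  moreover have "W1_push \<psi> \<in> extensional W1_space" by (simp add: W1_push_def)
  ultimately show ?thesis by (simp add: Isom_def W W1_dist_distr_Isom[OF \<psi>])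
qed

section \<open>The isometry groups and their isomorphism\<close>

text \<open>Points are told apart by their distance functions. This gives injectivity for the
  surjections in \<open>Isom\<close> without metric axioms for \<open>d\<close>, and fits the
  determination of measures by distances to Dirac measures.\<close>

definition separating_dist :: "'a set \<Rightarrow> ('a \<Rightarrow> 'a \<Rightarrow> real) \<Rightarrow> bool" where
  "separating_dist M d \<longleftrightarrow> (\<forall>x\<in>M. \<forall>y\<in>M. (\<forall>z\<in>M. d x z = d y z) \<longrightarrow> x = y)"

text \<open>Points with the same image have equal distances to every \<open>f z\<close>, hence to
  every \<open>z\<close>.\<close>

lemma Isom_bij_betw:
  assumes sep: "separating_dist M d" and f: "f \<in> Isom M d"
  shows "bij_betw f M M"
proof -
  have "x = y" if "x \<in> M" "y \<in> M" "f x = f y" for x y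
  proof -
    have "d x z = d y z" if "z \<in> M" for z
    proof -
      have iso: "d (f u) (f z) = d u z" if "u \<in> M" for u
        using f that \<open>z \<in> M\<close> by (simp add: Isom_def)
      show ?thesis using iso[OF \<open>x \<in> M\<close>] iso[OF \<open>y \<in> M\<close>] \<open>f x = f y\<close> by simp
    qed
    then show ?thesis using sep that by (auto simp: separating_dist_def)
  qed
  then show ?thesis using f by (auto simp: bij_betw_def inj_on_def Isom_def)
qed

lemma group_IsomGroup:
  assumes sep: "separating_dist M d"
  shows "group (IsomGroup M d)"
proof (rule groupI)
  fix f g h assume "f \<in> carrier (IsomGroup M d)" "g \<in> carrier (IsomGroup M d)"
    "h \<in> carrier (IsomGroup M d)"
  then have fM: "f \<in> M \<rightarrow> M" and hM: "h \<in> M \<rightarrow> M" by (auto simp: IsomGroup_def Isom_def)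
  then show "f \<otimes>\<^bsub>IsomGroup M d\<^esub> g \<otimes>\<^bsub>IsomGroup M d\<^esub> h =
      f \<otimes>\<^bsub>IsomGroup M d\<^esub> (g \<otimes>\<^bsub>IsomGroup M d\<^esub> h)"
    by (simp add: IsomGroup_def compose_assoc[OF hM])
next
  fix f g assume f: "f \<in> carrier (IsomGroup M d)" and g: "g \<in> carrier (IsomGroup M d)"
  then have "f ` M = M" "g ` M = M" by (auto simp: IsomGroup_def Isom_def)
  moreover from this have "compose M f g ` M = M"
    by (simp add: compose_def image_image[symmetric])
  moreover have "g x \<in> M" if "x \<in> M" for x using that \<open>g ` M = M\<close> by blast
  ultimately show "f \<otimes>\<^bsub>IsomGroup M d\<^esub> g \<in> carrier (IsomGroup M d)"
    using f g by (simp add: IsomGroup_def Isom_def compose_def)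
next
  show "\<one>\<^bsub>IsomGroup M d\<^esub> \<in> carrier (IsomGroup M d)" by (simp add: IsomGroup_def Isom_def)
next
  fix f assume "f \<in> carrier (IsomGroup M d)"
  then have f: "f \<in> Isom M d" by (simp add: IsomGroup_def)
  then have ext: "f \<in> extensional M" and im: "f ` M = M" by (auto simp: Isom_def)
  then have fM: "f \<in> M \<rightarrow> M" by auto
  then show "\<one>\<^bsub>IsomGroup M d\<^esub> \<otimes>\<^bsub>IsomGroup M d\<^esub> f = f"
    using Id_compose[OF fM ext] by (simp add: IsomGroup_def)
  have bij: "bij_betw f M M" by (rule Isom_bij_betw[OF sep f])
  \<comment> \<open>The inverse is restricted to \<open>M\<close> to make it extensional, as
    \<open>Isom\<close> demands.\<close>
  define g where "g = (\<lambda>x\<in>M. inv_into M f x)"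
  have gM: "g x \<in> M" "f (g x) = x" if "x \<in> M" for x
    using that im by (simp_all add: g_def inv_into_into f_inv_into_f)
  have "g ` M = M"
    using bij_betw_inv_into[OF bij] by (simp add: g_def bij_betw_def)
  moreover have "d (g x) (g y) = d x y" if "x \<in> M" "y \<in> M" for x y
  proof -
    have "d (f (g x)) (f (g y)) = d (g x) (g y)"
      using f gM(1) that by (simp add: Isom_def)
    then show ?thesis using gM(2) that by simp
  qed
  ultimately have "g \<in> Isom M d" by (simp add: Isom_def g_def)
  moreover have "compose M g f = (\<lambda>x\<in>M. x)"
    unfolding g_def by (rule compose_inv_into_id[OF bij])
  ultimately show "\<exists>g\<in>carrier (IsomGroup M d). g \<otimes>\<^bsub>IsomGroup M d\<^esub> f = \<one>\<^bsub>IsomGroup M d\<^esub>"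
    by (auto simp: IsomGroup_def)
qed

lemma separating_dist_real: "separating_dist (UNIV :: real set) dist"
  unfolding separating_dist_def by (metis dist_eq_0_iff)

lemma separating_dist_W1: "separating_dist W1_space W1_dist"
  unfolding separating_dist_def using dirac_W1 W1_eq_if_dist_dirac_eq by blast

lemma group_hom_W1_push:
  "group_hom (IsomGroup (UNIV :: real set) dist) (IsomGroup W1_space W1_dist) W1_push"
proof -
  have "W1_push (compose UNIV \<psi> \<tau>) = compose W1_space (W1_push \<psi>) (W1_push \<tau>)"
    if \<psi>: "\<psi> \<in> Isom (UNIV :: real set) dist" and \<tau>: "\<tau> \<in> Isom (UNIV :: real set) dist" for \<psi> \<tau>
    using Isom_realD(4)[OF \<psi>] Isom_realD(4)[OF \<tau>] distr_Isom_W1[OF \<tau>]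
    by (auto simp: fun_eq_iff W1_push_def compose_def distr_distr W1_spaceD(5) comp_def restrict_def)
  then show ?thesis
    using group_IsomGroup[OF separating_dist_real] group_IsomGroup[OF separating_dist_W1] W1_push_Isom
    by (auto simp: group_hom_def group_hom_axioms_def hom_def IsomGroup_def)
qed

text \<open>The image of \<open>dirac t\<close> is the Dirac measure at \<open>\<psi> t\<close>, so
  the push-forward remembers every value of \<psi>.\<close>

lemma inj_on_W1_push: "inj_on W1_push (Isom (UNIV :: real set) dist)"
proof (intro inj_onI ext)
  fix \<psi> \<tau> :: "real \<Rightarrow> real" and t
  assume Isom: "\<psi> \<in> Isom UNIV dist" "\<tau> \<in> Isom UNIV dist" and eq: "W1_push \<psi> = W1_push \<tau>"
  have push: "W1_push \<sigma> (dirac t) = dirac (\<sigma> t)" if "\<sigma> \<in> Isom UNIV dist" for \<sigma>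
    using Isom_realD(4)[OF that] by (simp add: W1_push_def dirac_W1 distr_return)
  show "\<psi> t = \<tau> t" using push[OF Isom(1)] push[OF Isom(2)] eq by simp
qed

lemma W1_push_image: "W1_push ` Isom (UNIV :: real set) dist = Isom W1_space W1_dist"
proof
  show "W1_push ` Isom (UNIV :: real set) dist \<subseteq> Isom W1_space W1_dist"
    using W1_push_Isom by blast
  show "Isom W1_space W1_dist \<subseteq> W1_push ` Isom (UNIV :: real set) dist"
  proof
    fix \<phi> assume \<phi>: "\<phi> \<in> Isom W1_space W1_dist"
    then obtain \<psi> where \<psi>: "\<psi> \<in> Isom UNIV dist" "\<forall>\<mu>\<in>W1_space. \<phi> \<mu> = distr \<mu> borel \<psi>"
      using W1_isometry_distr[OF Isom_bij_betw[OF separating_dist_W1 \<phi>]] by (auto simp: Isom_def)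
    \<comment> \<open>Both maps are extensional, so agreement on \<open>W1_space\<close> is
      equality.\<close>
    have "\<phi> = W1_push \<psi>"
      using \<phi> \<psi>(2) by (intro extensionalityI[of _ W1_space]) (auto simp: Isom_def W1_push_def)
    with \<psi>(1) show "\<phi> \<in> W1_push ` Isom UNIV dist" by blast
  qed
qed

theorem theorem3p7:
  shows
    "(\<forall>\<phi>. bij_betw \<phi> W1_space W1_space \<and>
          (\<forall>\<mu>\<in>W1_space. \<forall>\<nu>\<in>W1_space. W1_dist (\<phi> \<mu>) (\<phi> \<nu>) = W1_dist \<mu> \<nu>) \<longrightarrow>
          (\<exists>\<psi>\<in>Isom (UNIV :: real set) dist. \<forall>\<mu>\<in>W1_space. \<phi> \<mu> = distr \<mu> borel \<psi>)) \<and>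
     group_hom (IsomGroup (UNIV :: real set) dist) (IsomGroup W1_space W1_dist) W1_push \<and>
     inj_on W1_push (Isom (UNIV :: real set) dist) \<and>
     W1_push ` Isom (UNIV :: real set) dist = Isom W1_space W1_dist"
  using W1_isometry_distr group_hom_W1_push inj_on_W1_push W1_push_image by auto

end
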